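(* Let $n$ be a positive integer, let $D$ be the incidence matrix of a finite affine plane of order $n$, let $m=n^2+n$, and let $\vec{s}=(\tfrac1{n^2},\tfrac1{n^2},\dots,\tfrac1{n^2})^T\in\mathbb{R}^{n^2}$. Then $(D,\vec{s})$ is an ATAC data distribution on $m$ machines with minimal data storage limit, i.e. $L(D,\vec{s})=L_{\min}(m)$.
   Context: A data distribution on $m$ machines is a pair $(D,\vec{s})$, where, for some positive integer $x$ (the number of data groups, not fixed in advance), $D=(d_{ij})$ is an $m\times x$ matrix with entries in $\{0,1\}$ ($d_{ij}=1$ iff data group $j$ is stored on machine $i$), and $\vec{s}\in\mathbb{R}^x$ is a column vector with non-negative entries summing to $1$ ($s_j$ is the fraction of all data lying in data group $j$). It is an ATAC (All-to-All Comparison) data distribution if every entry of $D^TD$ is nonzero, i.e. for every pair of data groups (including a group paired with itself) some machine holds both. The data storage limit of $(D,\vec{s})$ is $L(D,\vec{s})=\max_{1\le i\le m}(D\vec{s})_i$. The minimal data storage limit $L_{\min}(m)$ is the minimum of $L(D,\vec{s})$ over all ATAC data distributions on $m$ machines (over all $x$). A finite affine plane of order $n$ is a set of $n^2$ points and $n^2+n$ lines with an incidence relation such that: every pair of distinct points has exactly one line passing through both; every line contains $n$ points; every point is on $n+1$ lines. Its incidence matrix has rows indexed by lines and columns indexed by points, with entry $1$ if the line contains the point and $0$ otherwise. *)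

theory Defs
  imports Complex_Main "Jordan_Normal_Form.Matrix"
begin

definition data_distribution :: "nat \<Rightarrow> real mat \<Rightarrow> real vec \<Rightarrow> bool" where
  "data_distribution m D s \<longleftrightarrow>
     (\<exists>x > 0. D \<in> carrier_mat m x \<and> s \<in> carrier_vec x \<and>
        (\<forall>i<m. \<forall>j<x. D $$ (i, j) \<in> {0, 1}) \<and>
        (\<forall>j<x. 0 \<le> s $ j) \<and>
        (\<Sum>j<x. s $ j) = 1)"

definition atac_data_distribution :: "nat \<Rightarrow> real mat \<Rightarrow> real vec \<Rightarrow> bool" where
  "atac_data_distribution m D s \<longleftrightarrow>
     data_distribution m D s \<and>
     (\<forall>j<dim_col D. \<forall>k<dim_col D. (transpose_mat D * D) $$ (j, k) \<noteq> 0)"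

definition storage_limit :: "real mat \<Rightarrow> real vec \<Rightarrow> real" where
  "storage_limit D s = Max {(D *\<^sub>v s) $ i | i. i < dim_row D}"

text \<open>The number of data groups is \<open>dim_col D\<close>, so quantifying over all \<open>D\<close> and \<open>s\<close>
  also ranges over all numbers of data groups. The value is meaningful only if the minimum is
  attained (in particular, not for \<open>m = 0\<close>).\<close>

definition min_storage_limit :: "nat \<Rightarrow> real" where
  "min_storage_limit m =
     (LEAST l. \<exists>D s. atac_data_distribution m D s \<and> l = storage_limit D s)"

text \<open>Lines are abstract objects rather than point sets: for \<open>n = 1\<close> there is a single point
  and two distinct lines, both incident with it.\<close>

definition finite_affine_plane ::
    "nat \<Rightarrow> 'p set \<Rightarrow> 'l set \<Rightarrow> ('p \<Rightarrow> 'l \<Rightarrow> bool) \<Rightarrow> bool" where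
  "finite_affine_plane n P B I \<longleftrightarrow>
     finite P \<and> card P = n\<^sup>2 \<and>
     finite B \<and> card B = n\<^sup>2 + n \<and>
     (\<forall>p\<in>P. \<forall>q\<in>P. p \<noteq> q \<longrightarrow> (\<exists>!b. b \<in> B \<and> I p b \<and> I q b)) \<and>
     (\<forall>b\<in>B. card {p \<in> P. I p b} = n) \<and>
     (\<forall>p\<in>P. card {b \<in> B. I p b} = n + 1)"

text \<open>An incidence matrix is determined only up to the order of its rows and columns; the
  predicate holds for the matrix of every enumeration of the lines and points.\<close>

definition is_incidence_matrix ::
    "'p set \<Rightarrow> 'l set \<Rightarrow> ('p \<Rightarrow> 'l \<Rightarrow> bool) \<Rightarrow> real mat \<Rightarrow> bool" where
  "is_incidence_matrix P B I D \<longleftrightarrow>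
     (\<exists>line point.
        bij_betw line {..<card B} B \<and> bij_betw point {..<card P} P \<and>
        D = mat (card B) (card P) (\<lambda>(i, j). if I (point j) (line i) then 1 else 0))"

end

theory Submission
  imports Defs
begin

text \<open>
  Let every load be at most \<open>L\<close> and view the column \<open>k\<close> of \<open>D\<close> as the set of machines holding
  group \<open>k\<close>. Every group meets group \<open>k\<close>, so the loads of the machines holding \<open>k\<close> add up to at
  least 1, whence \<open>L \<ge> 1/n\<close> if some group is held by at most \<open>n\<close> machines. Otherwise every group
  is held by at least \<open>n + 1\<close> machines, the total load is at least \<open>n + 1\<close>, and averaging over
  the \<open>n (n + 1)\<close> machines gives \<open>L \<ge> 1/n\<close> again. In an affine plane every load equals \<open>1/n\<close>.
\<close>

lemma mult_mat_vec_index_sum: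
  assumes "D \<in> carrier_mat m x" "s \<in> carrier_vec x" "i < m"
  shows "(D *\<^sub>v s) $ i = (\<Sum>j<x. D $$ (i, j) * s $ j)"
  using assms by (auto simp: scalar_prod_def lessThan_atLeast0)

lemma gram_index_sum:
  assumes "D \<in> carrier_mat m x" "j < x" "k < x"
  shows "(transpose_mat D * D) $$ (j, k) = (\<Sum>i<m. D $$ (i, j) * D $$ (i, k))"
  using assms by (auto simp: scalar_prod_def lessThan_atLeast0)

lemma load_le_storage_limit:
  assumes "i < dim_row D"
  shows "(D *\<^sub>v s) $ i \<le> storage_limit D s"
  unfolding storage_limit_def using assms by (intro Max_ge) (auto simp del: index_mult_mat_vec)

lemma storage_limit_constant:
  assumes "dim_row D > 0" "\<And>i. i < dim_row D \<Longrightarrow> (D *\<^sub>v s) $ i = c"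
  shows "storage_limit D s = c"
proof -
  have "{(D *\<^sub>v s) $ i | i. i < dim_row D} = {c}"
    using assms by (auto simp del: index_mult_mat_vec)
  then show ?thesis by (simp add: storage_limit_def)
qed

lemma storage_limit_ge:
  assumes "n > 0" and atac: "atac_data_distribution (n\<^sup>2 + n) D s"
  shows "1 / real n \<le> storage_limit D s"
proof -
  define m where "m = n\<^sup>2 + n"
  define L where "L = storage_limit D s"
  from atac obtain x where "x > 0"
    and carrier: "D \<in> carrier_mat m x" "s \<in> carrier_vec x"
    and binary: "\<And>i j. i < m \<Longrightarrow> j < x \<Longrightarrow> D $$ (i, j) \<in> {0, 1}"
    and nonneg: "\<And>j. j < x \<Longrightarrow> 0 \<le> s $ j"
    and sum_s: "(\<Sum>j<x. s $ j) = 1"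
    by (auto simp: atac_data_distribution_def data_distribution_def m_def)
  define copies where "copies j = (\<Sum>i<m. D $$ (i, j))" for j
  have load: "(\<Sum>j<x. D $$ (i, j) * s $ j) \<le> L" if "i < m" for i
    using load_le_storage_limit[of i D s] carrier that
    by (simp add: L_def mult_mat_vec_index_sum[OF carrier that])
  have nonneg_D: "0 \<le> D $$ (i, j)" if "i < m" "j < x" for i j
    using binary[OF that] by auto
  \<comment> \<open>Needed to replace \<open>copies k\<close> by its upper bound \<open>n\<close> in
    the product with \<open>L\<close>. The load of machine 0 is a witness, since \<open>m\<close> is
    positive.\<close>
  have L_nonneg: "0 \<le> L"
  proof -
    have "0 < m" using \<open>n > 0\<close> by (simp add: m_def)
    have "0 \<le> (\<Sum>j<x. D $$ (0, j) * s $ j)"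
      using nonneg nonneg_D \<open>0 < m\<close> by (auto intro!: sum_nonneg)
    with load[OF \<open>0 < m\<close>] show ?thesis by linarith
  qed
  \<comment> \<open>All products are 0 or 1, so a nonzero sum has a term equal to 1 and no negative
    terms.\<close>
  have gram: "1 \<le> (\<Sum>i<m. D $$ (i, k) * D $$ (i, j))" if "j < x" "k < x" for j k
  proof -
    have "(\<Sum>i<m. D $$ (i, k) * D $$ (i, j)) \<noteq> 0"
      using atac carrier that gram_index_sum[OF carrier(1) that(2,1)]
      by (auto simp: atac_data_distribution_def)
    then obtain i where i: "i < m" "D $$ (i, k) * D $$ (i, j) \<noteq> 0"
      by (meson lessThan_iff sum.neutral)
    then have "D $$ (i, k) * D $$ (i, j) = 1"
      using binary[OF i(1) that(1)] binary[OF i(1) that(2)] by auto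
    moreover have "D $$ (i, k) * D $$ (i, j) \<le> (\<Sum>i<m. D $$ (i, k) * D $$ (i, j))"
      using i(1) that nonneg_D by (intro member_le_sum) auto
    ultimately show ?thesis by simp
  qed
  have "1 \<le> real n * L"
  proof (cases "\<exists>k<x. copies k \<le> real n")
    case True
    then obtain k where k: "k < x" "copies k \<le> real n" by blast
    \<comment> \<open>Average \<open>gram\<close> over \<open>j\<close> with the weights
      \<open>s\<close>, whose sum is the 1 on the left. Swapping the sums then gives the total load
      of the machines holding group \<open>k\<close>.\<close>
    have "1 \<le> (\<Sum>j<x. (\<Sum>i<m. D $$ (i, k) * D $$ (i, j)) * s $ j)"
      unfolding sum_s[symmetric]
      using mult_right_mono[OF gram[OF _ k(1)] nonneg] by (intro sum_mono) auto
    also have "\<dots> = (\<Sum>i<m. D $$ (i, k) * (\<Sum>j<x. D $$ (i, j) * s $ j))"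
      unfolding sum_distrib_left sum_distrib_right mult.assoc by (rule sum.swap)
    also have "\<dots> \<le> (\<Sum>i<m. D $$ (i, k) * L)"
      using load nonneg_D k(1) by (intro sum_mono mult_left_mono) auto
    also have "\<dots> = copies k * L"
      by (simp add: copies_def sum_distrib_right)
    also have "\<dots> \<le> real n * L"
      using k(2) L_nonneg by (rule mult_right_mono)
    finally show ?thesis .
  next
    case False
    \<comment> \<open>\<open>copies j\<close> is a real sum, but it counts machines. Being an
      integer above \<open>n\<close>, it is at least \<open>n + 1\<close>; the bare strict
      inequality would be too weak for the averaging.\<close>
    have copies_ge: "real n + 1 \<le> copies j" if "j < x" for j
    proof -
      have "copies j = real (card {i \<in> {..<m}. D $$ (i, j) = 1})"
      proof -
        have "copies j = (\<Sum>i<m. if D $$ (i, j) = 1 then 1 else 0)"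
          unfolding copies_def using binary that by (intro sum.cong) force+
        then show ?thesis by (simp add: sum.If_cases Int_def)
      qed
      moreover have "real n < copies j" using False that by force
      ultimately show ?thesis by simp
    qed
    have "real n + 1 = (\<Sum>j<x. (real n + 1) * s $ j)"
      by (simp add: sum_distrib_left[symmetric] sum_s)
    also have "\<dots> \<le> (\<Sum>j<x. copies j * s $ j)"
      using copies_ge nonneg by (intro sum_mono mult_right_mono) auto
    also have "\<dots> = (\<Sum>i<m. \<Sum>j<x. D $$ (i, j) * s $ j)"
      unfolding copies_def sum_distrib_right by (rule sum.swap)
    also have "\<dots> \<le> (\<Sum>i<m. L)"
      using load by (intro sum_mono) auto
    \<comment> \<open>Here \<open>m\<close> factors as \<open>n (n + 1)\<close>, so that
      \<open>n + 1\<close> cancels against the lower bound on the total load.\<close>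
    also have "\<dots> = (real n + 1) * (real n * L)"
      by (simp add: m_def power2_eq_square algebra_simps)
    finally have "(real n + 1) * 1 \<le> (real n + 1) * (real n * L)" by simp
    then show ?thesis by (rule mult_left_le_imp_le) simp
  qed
  then show ?thesis
    using \<open>n > 0\<close> by (simp add: L_def field_simps)
qed

text \<open>Any two points share a line, so no Gram entry vanishes. Each line carries
  \<open>n\<close> points of weight \<open>1 / n\<^sup>2\<close>, so all loads are equal and their
  maximum is the common value.\<close>

lemma affine_plane_atac:
  assumes "n > 0" and plane: "finite_affine_plane n P B I"
    and inc: "is_incidence_matrix P B I D"
    and s: "s = vec (n\<^sup>2) (\<lambda>j. 1 / real (n\<^sup>2))"
  shows "atac_data_distribution (n\<^sup>2 + n) D s" and "storage_limit D s = 1 / real n"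
proof -
  have cards: "card P = n\<^sup>2" "card B = n\<^sup>2 + n"
    using plane by (auto simp: finite_affine_plane_def)
  from inc obtain line point
    where line: "bij_betw line {..<n\<^sup>2 + n} B" and point: "bij_betw point {..<n\<^sup>2} P"
      and D: "D = mat (n\<^sup>2 + n) (n\<^sup>2) (\<lambda>(i, j). if I (point j) (line i) then 1 else 0)"
    unfolding is_incidence_matrix_def cards by blast
  have carrier: "D \<in> carrier_mat (n\<^sup>2 + n) (n\<^sup>2)" "s \<in> carrier_vec (n\<^sup>2)"
    using D s by auto
  \<comment> \<open>The joining axiom covers only distinct points. The diagonal Gram entries need a
    line through a single point, which the count \<open>n + 1\<close> of lines per point
    supplies.\<close>
  have common: "\<exists>b\<in>B. I p b \<and> I q b" if "p \<in> P" "q \<in> P" for p q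
  proof (cases "p = q")
    case True
    have "card {b \<in> B. I p b} = n + 1"
      using plane that by (simp add: finite_affine_plane_def)
    then have "{b \<in> B. I p b} \<noteq> {}" by (metis card.empty Suc_eq_plus1 nat.distinct(1))
    with True show ?thesis by blast
  next
    case False
    moreover have "\<forall>p\<in>P. \<forall>q\<in>P. p \<noteq> q \<longrightarrow> (\<exists>!b. b \<in> B \<and> I p b \<and> I q b)"
      using plane by (simp add: finite_affine_plane_def)
    ultimately show ?thesis using that by blast
  qed
  have "(transpose_mat D * D) $$ (j, k) \<noteq> 0" if jk: "j < n\<^sup>2" "k < n\<^sup>2" for j k
  proof -
    have "point j \<in> P" "point k \<in> P"
      using bij_betwE[OF point] jk by auto
    then obtain b where "b \<in> B" "I (point j) b" "I (point k) b"
      using common by blast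
    moreover then obtain i where "i < n\<^sup>2 + n" "b = line i"
      using line by (auto simp: bij_betw_def)
    ultimately have "0 < (\<Sum>i<n\<^sup>2 + n. D $$ (i, j) * D $$ (i, k))"
      using jk by (intro sum_pos2[of _ i]) (auto simp: D)
    then show ?thesis by (simp add: gram_index_sum[OF carrier(1) jk])
  qed
  moreover have "data_distribution (n\<^sup>2 + n) D s"
    unfolding data_distribution_def
    using carrier \<open>n > 0\<close> by (intro exI[of _ "n\<^sup>2"]) (auto simp: D s)
  ultimately show "atac_data_distribution (n\<^sup>2 + n) D s"
    using carrier by (simp add: atac_data_distribution_def)
  show "storage_limit D s = 1 / real n"
  proof (rule storage_limit_constant)
    show "0 < dim_row D" using \<open>n > 0\<close> by (simp add: D)
  next
    fix i assume "i < dim_row D"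
    then have i: "i < n\<^sup>2 + n" by (simp add: D)
    then have "line i \<in> B" using bij_betwE[OF line] by auto
    \<comment> \<open>The enumeration carries the columns with a 1 in row \<open>i\<close> to the
      points on \<open>line i\<close>, so the row has exactly \<open>n\<close> ones.\<close>
    have "bij_betw point {j \<in> {..<n\<^sup>2}. I (point j) (line i)} {p \<in> P. I p (line i)}"
      using point by (auto simp: bij_betw_def inj_on_def)
    then have "card {j \<in> {..<n\<^sup>2}. I (point j) (line i)} = card {p \<in> P. I p (line i)}"
      by (rule bij_betw_same_card)
    then have "card {j \<in> {..<n\<^sup>2}. I (point j) (line i)} = n"
      using plane \<open>line i \<in> B\<close> by (simp add: finite_affine_plane_def)
    moreover have "(D *\<^sub>v s) $ i
        = (\<Sum>j<n\<^sup>2. if I (point j) (line i) then 1 / real (n\<^sup>2) else 0)"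
      unfolding mult_mat_vec_index_sum[OF carrier i] using i by (intro sum.cong) (auto simp: D s)
    ultimately show "(D *\<^sub>v s) $ i = 1 / real n"
      by (simp add: sum.If_cases Int_def power2_eq_square)
  qed
qed

theorem theorem10:
  fixes n m :: nat
    and P :: "'p set" and B :: "'l set" and I :: "'p \<Rightarrow> 'l \<Rightarrow> bool"
    and D :: "real mat" and s :: "real vec"
  assumes "n > 0"
    and "finite_affine_plane n P B I"
    and "is_incidence_matrix P B I D"
    and "m = n\<^sup>2 + n"
    and "s = vec (n\<^sup>2) (\<lambda>j. 1 / real (n\<^sup>2))"
  shows "atac_data_distribution m D s \<and> storage_limit D s = min_storage_limit m"
proof -
  have atac: "atac_data_distribution m D s" and limit: "storage_limit D s = 1 / real n"
    using affine_plane_atac[OF assms(1,2,3,5)] assms(4) by auto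
  have "min_storage_limit m = 1 / real n"
    unfolding min_storage_limit_def
  \<comment> \<open>The reals are not well-ordered, so \<open>LEAST\<close> is determined by showing
    that the value is attained, here by the plane, and bounds every ATAC distribution from
    below.\<close>
  proof (rule Least_equality)
    show "\<exists>D s. atac_data_distribution m D s \<and> 1 / real n = storage_limit D s"
      using atac limit by metis
  qed (use storage_limit_ge[OF assms(1)] assms(4) in blast)
  with atac limit show ?thesis by simp
qed

end
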